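(* Assume that $\widehat F\colon H^1(\Omega)\times[H^1(\Omega)]^d\to\mathbb R$ is Fréchet differentiable, that the reduced functional $F$ has a Fréchet derivative admitting a primal representation $\nabla F\colon\mathcal A\to L^\infty(\Omega)$, and that $\nabla F$ is completely continuous from $\mathcal A$ into $L^2(\Omega)$. Let $\{\alpha_k\}$ be a sequence of positive scalars, let $\{\rho_k\},\{\mu_k\},\{\psi_k\}$ be generated by the SiMPL update with step sizes $\alpha_k$, and let $\lambda_{k+1}=(\psi_{k+1}-\psi_k)/\alpha_k$. Let $K_{\rm w}\subset\mathbb N$ be an infinite index set such that $\{\rho_k\}_{k\in K_{\rm w}}$ converges weakly in $L^p(\Omega)$, for $p\in[1,\infty)$, to some $\rho^\star\in\mathcal A$. Then there exist an infinite index set $K_{\rm w}'\subset K_{\rm w}$ and limits $\mu^\star\in\mathbb R$, $\lambda^\star\in L^2(\Omega)$ such that, as $k\to\infty$ within $K_{\rm w}'$, $$\mu_{k+1}/\alpha_k\to\mu^\star\ \text{ in }\mathbb R,\qquad\lambda_{k+1}\to\lambda^\star\ \text{ strongly in }L^2(\Omega).$$ Moreover, these limits satisfy the stationarity equation $$\nabla F(\rho^\star)+\lambda^\star+\mu^\star=0.$$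
   Context: $\Omega\subset\mathbb R^d$ ($d=2$ or $3$) is a bounded open domain with Lipschitz boundary; $|\cdot|$ is Lebesgue measure; $0\le\theta\le1$ is fixed. $L^p_\theta(\Omega)=\{\rho\in L^p(\Omega):\int_\Omega\rho\,dx=\theta|\Omega|\}$, $L^p_{[0,1]}(\Omega)=\{\rho\in L^p(\Omega):0\le\rho\le1\text{ a.e.}\}$, $\mathcal A=L^p_\theta(\Omega)\cap L^p_{[0,1]}(\Omega)$ (the same set for every $p$), $\operatorname{int}L^\infty_{[0,1]}(\Omega)=\{\rho\in L^\infty(\Omega):\operatorname{ess\,inf}\rho>0,\ \operatorname{ess\,sup}\rho<1\}$, and $\mathring{\mathcal A}=L^\infty_\theta(\Omega)\cap\operatorname{int}L^\infty_{[0,1]}(\Omega)$. "Completely continuous from $\mathcal A$ into $L^2(\Omega)$" means that weakly convergent sequences in $\mathcal A$ are mapped to strongly convergent sequences in $L^2(\Omega)$ (with limit the image of the weak limit). Reduced objective: for a density $\rho$ with $0\le\rho\le1$, $\tilde\rho\in H^1(\Omega)$ is the weak solution of $-\epsilon^2\Delta\tilde\rho+\tilde\rho=\rho$ in $\Omega$, $\nabla\tilde\rho\cdot n=0$ on $\partial\Omega$ ($\epsilon>0$ fixed); $u\in V=\{v\in[H^1(\Omega)]^d:v|_{\Gamma_0}=0\}$ is the weak solution of $-\operatorname{div}(r(\tilde\rho)\mathsf C\varepsilon(u))=f$ in $\Omega$, $u=0$ on $\Gamma_0$, $(\mathsf C\varepsilon(u))\cdot n=0$ on $\partial\Omega\setminus\Gamma_0$,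 where $\Gamma_0\subset\partial\Omega$ has positive Hausdorff measure, $\varepsilon(u)=(\nabla u+\nabla u^\top)/2$, $\mathsf C$ is a symmetric positive-definite elasticity tensor, $f$ is a given body force (such that the weak problem is well posed, e.g. $f\in[L^2(\Omega)]^d$), and $r(t)=\underline\rho+(1-\underline\rho)t^s$ with $0<\underline\rho\ll1$, $s>1$. The reduced objective is $F(\rho)=\widehat F(\tilde\rho(\rho),u(\tilde\rho(\rho)))$. Its Fréchet derivative (with respect to $L^\infty(\Omega)$) is represented by $\nabla F(\rho)$: $\langle F'(\rho),q\rangle=\int_\Omega\nabla F(\rho)q\,dx$ for all $q\in L^\infty(\Omega)$. SiMPL update: with $\sigma(t)=1/(1+e^{-t})$, start from some $\rho_0\in\mathring{\mathcal A}$ and, for $k=0,1,2,\dots$, set $\psi_k=\sigma^{-1}(\rho_k)$, $\psi_{k+1}=\psi_k-\alpha_k\nabla F(\rho_k)-\mu_{k+1}$, $\rho_{k+1}=\sigma(\psi_{k+1})$, where $\mu_{k+1}\in\mathbb R$ is the unique number with $\int_\Omega\sigma(\psi_k-\alpha_k\nabla F(\rho_k)-\mu_{k+1})\,dx=\theta|\Omega|$. All iterates $\rho_k$ then lie in $\mathring{\mathcal A}$. A subsequence converging weakly in every $L^p(\Omega)$, $p\in[1,\infty)$, to a point of $\mathcal A$ always exists.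
   Formalization: It is additionally assumed that ∇F is bounded from A into L^∞(Ω), i.e. the L^∞ norms of ∇F(ρ) are uniformly bounded over ρ in A; without this the quotients μ_{k+1}/α_k can be unbounded and the claim fails. *)

theory Defs
  imports "HOL-Analysis.Analysis" "HOL-Probability.Essential_Supremum"
begin

text \<open>
  Elements of a Lebesgue or Sobolev space over \<open>\<Omega>\<close> are represented by functions on the whole
  space, only their values almost everywhere on \<open>\<Omega>\<close> being relevant.  The norms below are therefore
  seminorms on representatives.  Every notion of boundedness, convergence or differentiability is
  taken with respect to these seminorms; in particular a functional that is bounded or Frechet
  differentiable in this sense is automatically invariant under changes on null sets.
\<close>

section \<open>Functionals, Lebesgue spaces, modes of convergence\<close>

definition bounded_functional ::
  "('a \<Rightarrow> 'b::real_vector) set \<Rightarrow> (('a \<Rightarrow> 'b) \<Rightarrow> real) \<Rightarrow> (('a \<Rightarrow> 'b) \<Rightarrow> real) \<Rightarrow> bool" where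
  "bounded_functional X N l \<longleftrightarrow>
     (\<forall>f\<in>X. \<forall>g\<in>X. l (\<lambda>x. f x + g x) = l f + l g) \<and>
     (\<forall>c. \<forall>f\<in>X. l (\<lambda>x. c *\<^sub>R f x) = c * l f) \<and>
     (\<exists>C. \<forall>f\<in>X. \<bar>l f\<bar> \<le> C * N f)"

definition Lp :: "real \<Rightarrow> 'a::euclidean_space set \<Rightarrow> ('a \<Rightarrow> 'b::euclidean_space) set" where
  "Lp p \<Omega> = {f \<in> borel_measurable (lebesgue_on \<Omega>).
               integrable (lebesgue_on \<Omega>) (\<lambda>x. norm (f x) powr p)}"

definition Lp_norm :: "real \<Rightarrow> 'a::euclidean_space set \<Rightarrow> ('a \<Rightarrow> 'b::euclidean_space) \<Rightarrow> real" where
  "Lp_norm p \<Omega> f = (LINT x|lebesgue_on \<Omega>. norm (f x) powr p) powr (1 / p)"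

definition ess_sup :: "'a::euclidean_space set \<Rightarrow> ('a \<Rightarrow> real) \<Rightarrow> ereal" where
  "ess_sup \<Omega> f = esssup (lebesgue_on \<Omega>) (\<lambda>x. ereal (f x))"

definition ess_inf :: "'a::euclidean_space set \<Rightarrow> ('a \<Rightarrow> real) \<Rightarrow> ereal" where
  "ess_inf \<Omega> f = - ess_sup \<Omega> (\<lambda>x. - f x)"

definition Linf :: "'a::euclidean_space set \<Rightarrow> ('a \<Rightarrow> real) set" where
  "Linf \<Omega> = {f \<in> borel_measurable (lebesgue_on \<Omega>). ess_sup \<Omega> (\<lambda>x. \<bar>f x\<bar>) < \<infinity>}"

definition Linf_norm :: "'a::euclidean_space set \<Rightarrow> ('a \<Rightarrow> real) \<Rightarrow> real" where
  "Linf_norm \<Omega> f = real_of_ereal (ess_sup \<Omega> (\<lambda>x. \<bar>f x\<bar>))"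

definition Lp_tendsto ::
  "real \<Rightarrow> 'a::euclidean_space set \<Rightarrow> ('i \<Rightarrow> 'a \<Rightarrow> real) \<Rightarrow> ('a \<Rightarrow> real) \<Rightarrow> 'i filter \<Rightarrow> bool" where
  "Lp_tendsto p \<Omega> f g F \<longleftrightarrow>
     (\<forall>\<^sub>F i in F. f i \<in> Lp p \<Omega>) \<and> g \<in> Lp p \<Omega> \<and>
     ((\<lambda>i. Lp_norm p \<Omega> (\<lambda>x. f i x - g x)) \<longlongrightarrow> 0) F"

definition Lp_weak_tendsto ::
  "real \<Rightarrow> 'a::euclidean_space set \<Rightarrow> ('i \<Rightarrow> 'a \<Rightarrow> real) \<Rightarrow> ('a \<Rightarrow> real) \<Rightarrow> 'i filter \<Rightarrow> bool" where
  "Lp_weak_tendsto p \<Omega> f g F \<longleftrightarrow>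
     (\<forall>\<^sub>F i in F. f i \<in> Lp p \<Omega>) \<and> g \<in> Lp p \<Omega> \<and>
     (\<forall>l. bounded_functional (Lp p \<Omega>) (Lp_norm p \<Omega>) l \<longrightarrow> ((\<lambda>i. l (f i)) \<longlongrightarrow> l g) F)"

definition along :: "nat set \<Rightarrow> nat filter" where
  "along K = inf sequentially (principal K)"

section \<open>Lipschitz domains and Hausdorff measure\<close>

text \<open>Near each boundary point the set is the strict epigraph, in direction \<open>e\<close>, of a Lipschitz
  function \<open>\<gamma>\<close> of the coordinates orthogonal to \<open>e\<close>.\<close>

definition lipschitz_boundary :: "'a::euclidean_space set \<Rightarrow> bool" where
  "lipschitz_boundary \<Omega> \<longleftrightarrow>
     (\<forall>x\<in>frontier \<Omega>. \<exists>r>0. \<exists>e \<gamma> L. norm e = 1 \<and> L-lipschitz_on {z. z \<bullet> e = 0} \<gamma> \<and>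
        \<Omega> \<inter> ball x r = {y \<in> ball x r. \<gamma> (y - (y \<bullet> e) *\<^sub>R e) < y \<bullet> e})"

definition lipschitz_domain :: "'a::euclidean_space set \<Rightarrow> bool" where
  "lipschitz_domain \<Omega> \<longleftrightarrow>
     \<Omega> \<noteq> {} \<and> bounded \<Omega> \<and> open \<Omega> \<and> connected \<Omega> \<and> lipschitz_boundary \<Omega>"

definition hausdorff_premeasure :: "real \<Rightarrow> real \<Rightarrow> 'a::metric_space set \<Rightarrow> ennreal" where
  "hausdorff_premeasure s \<delta> A =
     (INF U \<in> {U :: nat \<Rightarrow> 'a set. A \<subseteq> (\<Union>i. U i) \<and> (\<forall>i. bounded (U i) \<and> diameter (U i) \<le> \<delta>)}.
        \<Sum>i. ennreal (unit_ball_vol s * (diameter (U i) / 2) powr s))"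

definition hausdorff_outer_measure :: "real \<Rightarrow> 'a::metric_space set \<Rightarrow> ennreal" where
  "hausdorff_outer_measure s A = (SUP \<delta>\<in>{0<..}. hausdorff_premeasure s \<delta> A)"

text \<open>The outer measure is a metric outer measure, hence countably additive on Borel sets.\<close>

definition hausdorff_measure :: "real \<Rightarrow> 'a::metric_space measure" where
  "hausdorff_measure s = measure_of UNIV (sets borel) (hausdorff_outer_measure s)"

section \<open>Sobolev spaces\<close>

abbreviation partial :: "'n::finite \<Rightarrow> (real^'n \<Rightarrow> real) \<Rightarrow> real^'n \<Rightarrow> real" where
  "partial i f x \<equiv> frechet_derivative f (at x) (axis i 1)"

primrec Ck :: "nat \<Rightarrow> (real^'n::finite \<Rightarrow> real) \<Rightarrow> bool" where
  "Ck 0 f \<longleftrightarrow> continuous_on UNIV f"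
| "Ck (Suc k) f \<longleftrightarrow> (\<forall>x. f differentiable (at x)) \<and> (\<forall>i. Ck k (partial i f))"

definition smooth :: "(real^'n::finite \<Rightarrow> real) \<Rightarrow> bool" where
  "smooth f \<longleftrightarrow> (\<forall>k. Ck k f)"

definition test_functions :: "(real^'n::finite) set \<Rightarrow> (real^'n \<Rightarrow> real) set" where
  "test_functions \<Omega> =
     {\<phi>. smooth \<phi> \<and> compact (closure {x. \<phi> x \<noteq> 0}) \<and> closure {x. \<phi> x \<noteq> 0} \<subseteq> \<Omega>}"

definition is_weak_gradient ::
  "(real^'n::finite) set \<Rightarrow> (real^'n \<Rightarrow> real) \<Rightarrow> (real^'n \<Rightarrow> real^'n) \<Rightarrow> bool" where
  "is_weak_gradient \<Omega> u g \<longleftrightarrow>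
     (\<forall>\<phi>\<in>test_functions \<Omega>. \<forall>i.
        (LINT x|lebesgue_on \<Omega>. u x * partial i \<phi> x) = - (LINT x|lebesgue_on \<Omega>. g x $ i * \<phi> x))"

definition H1 :: "(real^'n::finite) set \<Rightarrow> (real^'n \<Rightarrow> real) set" where
  "H1 \<Omega> = {u \<in> Lp 2 \<Omega>. \<exists>g \<in> Lp 2 \<Omega>. is_weak_gradient \<Omega> u g}"

text \<open>The weak gradient is unique up to null sets.\<close>

definition weak_grad :: "(real^'n::finite) set \<Rightarrow> (real^'n \<Rightarrow> real) \<Rightarrow> real^'n \<Rightarrow> real^'n" where
  "weak_grad \<Omega> u = (SOME g. g \<in> Lp 2 \<Omega> \<and> is_weak_gradient \<Omega> u g)"

definition H1_norm :: "(real^'n::finite) set \<Rightarrow> (real^'n \<Rightarrow> real) \<Rightarrow> real" where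
  "H1_norm \<Omega> u = sqrt ((Lp_norm 2 \<Omega> u)\<^sup>2 + (Lp_norm 2 \<Omega> (weak_grad \<Omega> u))\<^sup>2)"

definition H1_vec :: "(real^'n::finite) set \<Rightarrow> (real^'n \<Rightarrow> real^'n) set" where
  "H1_vec \<Omega> = {u. \<forall>i. (\<lambda>x. u x $ i) \<in> H1 \<Omega>}"

definition H1_vec_norm :: "(real^'n::finite) set \<Rightarrow> (real^'n \<Rightarrow> real^'n) \<Rightarrow> real" where
  "H1_vec_norm \<Omega> u = sqrt (\<Sum>i\<in>UNIV. (H1_norm \<Omega> (\<lambda>x. u x $ i))\<^sup>2)"

definition weak_jacobian ::
  "(real^'n::finite) set \<Rightarrow> (real^'n \<Rightarrow> real^'n) \<Rightarrow> real^'n \<Rightarrow> real^'n^'n" where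
  "weak_jacobian \<Omega> u x = (\<chi> i. weak_grad \<Omega> (\<lambda>y. u y $ i) x)"

text \<open>The trace is the continuous extension of the restriction map from smooth functions to
  \<open>H1\<close>; on a Lipschitz domain, restrictions of smooth functions on the whole space are dense.\<close>

definition is_trace :: "(real^'n::finite) set \<Rightarrow> (real^'n \<Rightarrow> real) \<Rightarrow> (real^'n \<Rightarrow> real) \<Rightarrow> bool" where
  "is_trace \<Omega> u g \<longleftrightarrow> u \<in> H1 \<Omega> \<and> g \<in> borel_measurable borel \<and>
     (\<exists>\<phi> :: nat \<Rightarrow> real^'n \<Rightarrow> real. (\<forall>m. smooth (\<phi> m)) \<and>
        (\<lambda>m. H1_norm \<Omega> (\<lambda>x. \<phi> m x - u x)) \<longlonglongrightarrow> 0 \<and>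
        (\<lambda>m. \<integral>\<^sup>+x\<in>frontier \<Omega>. ennreal ((\<phi> m x - g x)\<^sup>2)
                \<partial>hausdorff_measure (real CARD('n) - 1)) \<longlonglongrightarrow> 0)"

definition V_space :: "(real^'n::finite) set \<Rightarrow> (real^'n) set \<Rightarrow> (real^'n \<Rightarrow> real^'n) set" where
  "V_space \<Omega> \<Gamma>0 = {v \<in> H1_vec \<Omega>. \<forall>i. \<exists>g. is_trace \<Omega> (\<lambda>x. v x $ i) g \<and>
     hausdorff_outer_measure (real CARD('n) - 1) {x\<in>\<Gamma>0. g x \<noteq> 0} = 0}"

section \<open>Filter equation, elasticity equation, reduced objective\<close>

definition is_filtered ::
  "(real^'n::finite) set \<Rightarrow> real \<Rightarrow> (real^'n \<Rightarrow> real) \<Rightarrow> (real^'n \<Rightarrow> real) \<Rightarrow> bool" where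
  "is_filtered \<Omega> \<epsilon> \<rho> w \<longleftrightarrow> w \<in> H1 \<Omega> \<and>
     (\<forall>v\<in>H1 \<Omega>. \<epsilon>\<^sup>2 * (LINT x|lebesgue_on \<Omega>. weak_grad \<Omega> w x \<bullet> weak_grad \<Omega> v x)
                + (LINT x|lebesgue_on \<Omega>. w x * v x) = (LINT x|lebesgue_on \<Omega>. \<rho> x * v x))"

definition filtered :: "(real^'n::finite) set \<Rightarrow> real \<Rightarrow> (real^'n \<Rightarrow> real) \<Rightarrow> real^'n \<Rightarrow> real" where
  "filtered \<Omega> \<epsilon> \<rho> = (SOME w. is_filtered \<Omega> \<epsilon> \<rho> w)"

definition elasticity_tensor :: "(real^'n^'n \<Rightarrow> real^'n^'n::finite) \<Rightarrow> bool" where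
  "elasticity_tensor C \<longleftrightarrow> linear C \<and>
     (\<forall>A B. C A \<bullet> B = A \<bullet> C B) \<and> (\<forall>A. C (transpose A) = C A) \<and>
     (\<forall>A. transpose A = A \<and> A \<noteq> 0 \<longrightarrow> C A \<bullet> A > 0)"

definition strain ::
  "(real^'n::finite) set \<Rightarrow> (real^'n \<Rightarrow> real^'n) \<Rightarrow> real^'n \<Rightarrow> real^'n^'n" where
  "strain \<Omega> u x = (1/2) *\<^sub>R (weak_jacobian \<Omega> u x + transpose (weak_jacobian \<Omega> u x))"

definition simp_interp :: "real \<Rightarrow> real \<Rightarrow> real \<Rightarrow> real" where
  "simp_interp \<rho>min s t = \<rho>min + (1 - \<rho>min) * t powr s"

text \<open>The body force enters as a functional \<open>f\<close> on \<open>V_space \<Omega> \<Gamma>0\<close>, which for a force density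
  \<open>b\<close> in \<open>L2\<close> is the integral of \<open>b \<bullet> v\<close>.\<close>

definition is_displacement ::
  "(real^'n::finite) set \<Rightarrow> (real^'n) set \<Rightarrow> (real^'n^'n \<Rightarrow> real^'n^'n) \<Rightarrow>
   ((real^'n \<Rightarrow> real^'n) \<Rightarrow> real) \<Rightarrow> real \<Rightarrow> real \<Rightarrow>
   (real^'n \<Rightarrow> real) \<Rightarrow> (real^'n \<Rightarrow> real^'n) \<Rightarrow> bool" where
  "is_displacement \<Omega> \<Gamma>0 C f \<rho>min s w u \<longleftrightarrow> u \<in> V_space \<Omega> \<Gamma>0 \<and>
     (\<forall>v\<in>V_space \<Omega> \<Gamma>0.
        (LINT x|lebesgue_on \<Omega>. simp_interp \<rho>min s (w x) * (C (strain \<Omega> u x) \<bullet> strain \<Omega> v x)) = f v)"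

definition displacement ::
  "(real^'n::finite) set \<Rightarrow> (real^'n) set \<Rightarrow> (real^'n^'n \<Rightarrow> real^'n^'n) \<Rightarrow>
   ((real^'n \<Rightarrow> real^'n) \<Rightarrow> real) \<Rightarrow> real \<Rightarrow> real \<Rightarrow>
   (real^'n \<Rightarrow> real) \<Rightarrow> real^'n \<Rightarrow> real^'n" where
  "displacement \<Omega> \<Gamma>0 C f \<rho>min s w = (SOME u. is_displacement \<Omega> \<Gamma>0 C f \<rho>min s w u)"

definition reduced_objective ::
  "(real^'n::finite) set \<Rightarrow> (real^'n) set \<Rightarrow> (real^'n^'n \<Rightarrow> real^'n^'n) \<Rightarrow>
   ((real^'n \<Rightarrow> real^'n) \<Rightarrow> real) \<Rightarrow> real \<Rightarrow> real \<Rightarrow> real \<Rightarrow>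
   ((real^'n \<Rightarrow> real) \<Rightarrow> (real^'n \<Rightarrow> real^'n) \<Rightarrow> real) \<Rightarrow> (real^'n \<Rightarrow> real) \<Rightarrow> real" where
  "reduced_objective \<Omega> \<Gamma>0 C f \<rho>min s \<epsilon> Fhat \<rho> =
     Fhat (filtered \<Omega> \<epsilon> \<rho>) (displacement \<Omega> \<Gamma>0 C f \<rho>min s (filtered \<Omega> \<epsilon> \<rho>))"

section \<open>Admissible densities and derivatives\<close>

definition Linf_01 :: "'a::euclidean_space set \<Rightarrow> ('a \<Rightarrow> real) set" where
  "Linf_01 \<Omega> = {\<rho> \<in> Linf \<Omega>. AE x in lebesgue_on \<Omega>. 0 \<le> \<rho> x \<and> \<rho> x \<le> 1}"

definition Linf_vol :: "'a::euclidean_space set \<Rightarrow> real \<Rightarrow> ('a \<Rightarrow> real) set" where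
  "Linf_vol \<Omega> \<theta> = {\<rho> \<in> Linf \<Omega>. (LINT x|lebesgue_on \<Omega>. \<rho> x) = \<theta> * measure lebesgue \<Omega>}"

definition admissible :: "'a::euclidean_space set \<Rightarrow> real \<Rightarrow> ('a \<Rightarrow> real) set" where
  "admissible \<Omega> \<theta> = Linf_vol \<Omega> \<theta> \<inter> Linf_01 \<Omega>"

definition int_Linf_01 :: "'a::euclidean_space set \<Rightarrow> ('a \<Rightarrow> real) set" where
  "int_Linf_01 \<Omega> = {\<rho> \<in> Linf \<Omega>. ess_inf \<Omega> \<rho> > 0 \<and> ess_sup \<Omega> \<rho> < 1}"

definition int_admissible :: "'a::euclidean_space set \<Rightarrow> real \<Rightarrow> ('a \<Rightarrow> real) set" where
  "int_admissible \<Omega> \<theta> = Linf_vol \<Omega> \<theta> \<inter> int_Linf_01 \<Omega>"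

text \<open>A bounded functional on a product splits as \<open>(h, k) \<mapsto> l1 h + l2 k\<close>.\<close>

definition Fhat_differentiable ::
  "(real^'n::finite) set \<Rightarrow> ((real^'n \<Rightarrow> real) \<Rightarrow> (real^'n \<Rightarrow> real^'n) \<Rightarrow> real) \<Rightarrow> bool" where
  "Fhat_differentiable \<Omega> Fhat \<longleftrightarrow>
     (\<forall>w\<in>H1 \<Omega>. \<forall>u\<in>H1_vec \<Omega>. \<exists>l1 l2.
        bounded_functional (H1 \<Omega>) (H1_norm \<Omega>) l1 \<and>
        bounded_functional (H1_vec \<Omega>) (H1_vec_norm \<Omega>) l2 \<and>
        (\<forall>e>0. \<exists>\<delta>>0. \<forall>h\<in>H1 \<Omega>. \<forall>k\<in>H1_vec \<Omega>. H1_norm \<Omega> h + H1_vec_norm \<Omega> k < \<delta> \<longrightarrow>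
           \<bar>Fhat (\<lambda>x. w x + h x) (\<lambda>x. u x + k x) - Fhat w u - (l1 h + l2 k)\<bar>
             \<le> e * (H1_norm \<Omega> h + H1_vec_norm \<Omega> k)))"

text \<open>Increments are restricted to those keeping the density in \<open>Linf_01 \<Omega>\<close>, where the reduced
  objective is defined.\<close>

definition has_Linf_derivative ::
  "'a::euclidean_space set \<Rightarrow> (('a \<Rightarrow> real) \<Rightarrow> real) \<Rightarrow> (('a \<Rightarrow> real) \<Rightarrow> real) \<Rightarrow> ('a \<Rightarrow> real) \<Rightarrow> bool" where
  "has_Linf_derivative \<Omega> F l \<rho> \<longleftrightarrow>
     bounded_functional (Linf \<Omega>) (Linf_norm \<Omega>) l \<and>
     (\<forall>e>0. \<exists>\<delta>>0. \<forall>q\<in>Linf \<Omega>. (\<lambda>x. \<rho> x + q x) \<in> Linf_01 \<Omega> \<and> Linf_norm \<Omega> q < \<delta> \<longrightarrow>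
        \<bar>F (\<lambda>x. \<rho> x + q x) - F \<rho> - l q\<bar> \<le> e * Linf_norm \<Omega> q)"

definition is_primal_gradient ::
  "'a::euclidean_space set \<Rightarrow> real \<Rightarrow> (('a \<Rightarrow> real) \<Rightarrow> real) \<Rightarrow> (('a \<Rightarrow> real) \<Rightarrow> 'a \<Rightarrow> real) \<Rightarrow> bool" where
  "is_primal_gradient \<Omega> \<theta> F gradF \<longleftrightarrow>
     (\<forall>\<rho>\<in>admissible \<Omega> \<theta>. gradF \<rho> \<in> Linf \<Omega> \<and>
        has_Linf_derivative \<Omega> F (\<lambda>q. LINT x|lebesgue_on \<Omega>. gradF \<rho> x * q x) \<rho>)"

text \<open>On admissible densities, weak convergence in \<open>Lp\<close> is the same for all finite \<open>p \<ge> 1\<close>.\<close>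

definition completely_continuous_L2 ::
  "'a::euclidean_space set \<Rightarrow> real \<Rightarrow> (('a \<Rightarrow> real) \<Rightarrow> 'a \<Rightarrow> real) \<Rightarrow> bool" where
  "completely_continuous_L2 \<Omega> \<theta> G \<longleftrightarrow>
     (\<forall>r r'. (\<forall>m::nat. r m \<in> admissible \<Omega> \<theta>) \<and> r' \<in> admissible \<Omega> \<theta> \<and>
        (\<forall>p\<ge>1. Lp_weak_tendsto p \<Omega> r r' sequentially) \<longrightarrow>
        Lp_tendsto 2 \<Omega> (\<lambda>m. G (r m)) (G r') sequentially)"

section \<open>The SiMPL iteration\<close>

definition sigmoid :: "real \<Rightarrow> real" where
  "sigmoid t = 1 / (1 + exp (- t))"

definition simpl_iteration ::
  "'a::euclidean_space set \<Rightarrow> real \<Rightarrow> (('a \<Rightarrow> real) \<Rightarrow> 'a \<Rightarrow> real) \<Rightarrow> (nat \<Rightarrow> real) \<Rightarrow>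
   (nat \<Rightarrow> 'a \<Rightarrow> real) \<Rightarrow> (nat \<Rightarrow> 'a \<Rightarrow> real) \<Rightarrow> (nat \<Rightarrow> real) \<Rightarrow> bool" where
  "simpl_iteration \<Omega> \<theta> gradF \<alpha> \<rho> \<psi> \<mu> \<longleftrightarrow>
     \<rho> 0 \<in> int_admissible \<Omega> \<theta> \<and>
     (\<forall>k. (AE x in lebesgue_on \<Omega>. \<psi> k x = inv sigmoid (\<rho> k x)) \<and>
          (AE x in lebesgue_on \<Omega>. \<psi> (Suc k) x = \<psi> k x - \<alpha> k * gradF (\<rho> k) x - \<mu> (Suc k)) \<and>
          (AE x in lebesgue_on \<Omega>. \<rho> (Suc k) x = sigmoid (\<psi> (Suc k) x)) \<and>
          (LINT x|lebesgue_on \<Omega>. sigmoid (\<psi> k x - \<alpha> k * gradF (\<rho> k) x - \<mu> (Suc k)))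
             = \<theta> * measure lebesgue \<Omega>)"

end

theory Submission
  imports Defs
begin

text \<open>Since \<open>\<lambda>\<^sub>k\<^sub>+\<^sub>1 = - \<nabla>F(\<rho>\<^sub>k) - \<mu>\<^sub>k\<^sub>+\<^sub>1 / \<alpha>\<^sub>k\<close> by the update rule, and \<open>\<nabla>F(\<rho>\<^sub>k)\<close> converges strongly along the
  subsequence by complete continuity, it suffices to bound \<open>\<mu>\<^sub>k\<^sub>+\<^sub>1 / \<alpha>\<^sub>k\<close> and apply
  Bolzano-Weierstrass.  The bound is \<open>\<bar>\<mu>\<^sub>k\<^sub>+\<^sub>1\<bar> \<le> \<alpha>\<^sub>k \<parallel>\<nabla>F(\<rho>\<^sub>k)\<parallel>\<^sub>\<infinity>\<close>: otherwise \<open>\<psi>\<^sub>k\<^sub>+\<^sub>1 - \<psi>\<^sub>k\<close> has a strict sign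
  almost everywhere, and by strict monotonicity of the sigmoid the volume would change.\<close>

section \<open>Index sets as filters and passage to subsequences\<close>

lemma along_range:
  assumes "strict_mono e"
  shows "along (range e) = filtermap e sequentially"
proof (rule filter_eqI)
  fix P
  \<comment> \<open>Tails of the range and tails of the enumeration are cofinal: a threshold
    \<open>N\<close> for values also works for arguments because \<open>N \<le> n \<le> e n\<close>,
    and a threshold \<open>N\<close> for arguments becomes \<open>e N\<close> for values.\<close>
  have inc: "n \<le> e n" for n
    using assms by (rule strict_mono_imp_increasing)
  have "eventually P (along (range e)) \<longleftrightarrow> (\<exists>N. \<forall>k\<ge>N. k \<in> range e \<longrightarrow> P k)"
    by (simp add: along_def eventually_inf_principal eventually_sequentially)
  also have "\<dots> \<longleftrightarrow> (\<exists>N. \<forall>n\<ge>N. P (e n))"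
  proof
    assume "\<exists>N. \<forall>k\<ge>N. k \<in> range e \<longrightarrow> P k"
    then show "\<exists>N. \<forall>n\<ge>N. P (e n)"
      using inc le_trans by blast
  next
    assume "\<exists>N. \<forall>n\<ge>N. P (e n)"
    then obtain N where "\<forall>n\<ge>N. P (e n)" by blast
    then have "\<forall>k\<ge>e N. k \<in> range e \<longrightarrow> P k"
      using strict_mono_less_eq[OF assms] by auto
    then show "\<exists>N. \<forall>k\<ge>N. k \<in> range e \<longrightarrow> P k" by blast
  qed
  finally show "eventually P (along (range e)) \<longleftrightarrow> eventually P (filtermap e sequentially)"
    by (simp add: eventually_filtermap eventually_sequentially)
qed

text \<open>Inclusion of the range in \<open>K\<close> is enough here, so every limit known along
  \<open>K\<close> passes to each sequence drawn from \<open>K\<close>.\<close>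

lemma filterlim_along:
  assumes "strict_mono e" "range e \<subseteq> K"
  shows "filterlim e (along K) sequentially"
  using filterlim_subseq[OF assms(1)] assms(2)
  by (auto simp: along_def filterlim_inf filterlim_principal intro!: always_eventually)

lemma Lp_weak_tendsto_compose:
  assumes "Lp_weak_tendsto p \<Omega> f g F" "filterlim e F F'"
  shows "Lp_weak_tendsto p \<Omega> (\<lambda>i. f (e i)) g F'"
proof -
  have "((\<lambda>i. l (f (e i))) \<longlongrightarrow> l g) F'" if "((\<lambda>i. l (f i)) \<longlongrightarrow> l g) F" for l :: "_ \<Rightarrow> real"
    using that assms(2) by (rule filterlim_compose)
  moreover have "\<forall>\<^sub>F i in F'. f (e i) \<in> Lp p \<Omega>"
    using assms by (intro eventually_compose_filterlim[of _ F e]) (simp_all add: Lp_weak_tendsto_def)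
  ultimately show ?thesis
    using assms(1) by (simp add: Lp_weak_tendsto_def)
qed

lemma Lp_tendsto_filtermap:
  "Lp_tendsto p \<Omega> f g (filtermap e F) \<longleftrightarrow> Lp_tendsto p \<Omega> (\<lambda>i. f (e i)) g F"
  by (simp add: Lp_tendsto_def eventually_filtermap filterlim_filtermap)

section \<open>Almost everywhere equality and the essential supremum\<close>

text \<open>The preimages of a set under \<open>f\<close> and \<open>g\<close> differ only inside a
  null set, which completeness makes measurable. The iteration fixes its functions only almost
  everywhere, so their measurability has to come from this.\<close>

lemma (in complete_measure) measurable_AE_cong:
  assumes f: "f \<in> measurable M N" and ae: "AE x in M. f x = g x"
    and g: "g \<in> space M \<rightarrow> space N"
  shows "g \<in> measurable M N"
proof (rule measurableI)
  show "g x \<in> space N" if "x \<in> space M" for x using that g by auto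
  fix A assume "A \<in> sets N"
  show "g -` A \<inter> space M \<in> sets M"
  proof (rule in_sets_AE)
    show "f -` A \<inter> space M \<in> sets M" using f \<open>A \<in> sets N\<close> by (rule measurable_sets)
    show "AE x in M. x \<in> f -` A \<inter> space M \<longleftrightarrow> x \<in> g -` A \<inter> space M"
      using ae by eventually_elim auto
  qed auto
qed

lemma complete_measure_lebesgue_on:
  assumes "S \<in> sets lebesgue"
  shows "complete_measure (lebesgue_on S)"
proof
  fix A B :: "'a set" assume "B \<subseteq> A" "A \<in> null_sets (lebesgue_on S)"
  then show "B \<in> sets (lebesgue_on S)"
    using assms completion.complete2[of B A lborel]
    by (auto simp: null_sets_restrict_space sets_restrict_space_iff)
qed

lemma borel_measurable_AE_cong_lebesgue_on:
  fixes f g :: "'a::euclidean_space \<Rightarrow> 'b::topological_space"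
  assumes "S \<in> sets lebesgue" "f \<in> borel_measurable (lebesgue_on S)"
    and "AE x in lebesgue_on S. f x = g x"
  shows "g \<in> borel_measurable (lebesgue_on S)"
  using complete_measure.measurable_AE_cong[OF complete_measure_lebesgue_on assms(2,3)] assms(1) by simp

lemma Linf_norm_AE:
  assumes "f \<in> Linf \<Omega>"
  shows "AE x in lebesgue_on \<Omega>. \<bar>f x\<bar> \<le> Linf_norm \<Omega> f"
proof -
  have fin: "ess_sup \<Omega> (\<lambda>x. \<bar>f x\<bar>) < \<infinity>"
    using assms by (simp add: Linf_def)
  have "AE x in lebesgue_on \<Omega>. ereal \<bar>f x\<bar> \<le> ess_sup \<Omega> (\<lambda>x. \<bar>f x\<bar>)"
    unfolding ess_sup_def by (rule esssup_AE)
  then show ?thesis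
  proof eventually_elim
    case (elim x)
    then show ?case
      \<comment> \<open>\<open>real_of_ereal\<close> sends both infinities to 0. Membership in
        \<open>Linf\<close> rules out the positive one, and the negative one contradicts the
        pointwise bound at \<open>x\<close>.\<close>
      using fin unfolding Linf_norm_def by (cases "ess_sup \<Omega> (\<lambda>x. \<bar>f x\<bar>)") auto
  qed
qed

lemma LinfI_AE_bounded:
  assumes "f \<in> borel_measurable (lebesgue_on \<Omega>)" "AE x in lebesgue_on \<Omega>. \<bar>f x\<bar> \<le> B"
  shows "f \<in> Linf \<Omega>"
proof -
  have "ess_sup \<Omega> (\<lambda>x. \<bar>f x\<bar>) \<le> ereal B"
    unfolding ess_sup_def using assms by (intro esssup_I) auto
  then show ?thesis
    using assms(1) by (auto simp: Linf_def)
qed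

lemma int_Linf_01_AE:
  assumes "f \<in> int_Linf_01 \<Omega>"
  shows "AE x in lebesgue_on \<Omega>. 0 < f x \<and> f x < 1"
proof -
  have less: "ess_sup \<Omega> (\<lambda>x. - f x) < 0" "ess_sup \<Omega> f < 1"
    using assms by (auto simp: int_Linf_01_def ess_inf_def ereal_less_uminus_reorder[of 0])
  have "AE x in lebesgue_on \<Omega>. ereal (- f x) \<le> ess_sup \<Omega> (\<lambda>x. - f x)"
    "AE x in lebesgue_on \<Omega>. ereal (f x) \<le> ess_sup \<Omega> f"
    unfolding ess_sup_def by (rule esssup_AE)+
  then show ?thesis
  proof eventually_elim
    case (elim x)
    then show ?case
      using le_less_trans[OF elim(1) less(1)] le_less_trans[OF elim(2) less(2)]
      by (auto simp: zero_ereal_def one_ereal_def)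
  qed
qed

section \<open>Convergence in mean square\<close>

lemma abs_powr_2: "\<bar>y::real\<bar> powr 2 = y\<^sup>2"
  by (cases "y = 0") (auto simp: powr_numeral)

lemma Lp_2_iff:
  fixes f :: "'a::euclidean_space \<Rightarrow> real"
  shows "f \<in> Lp 2 \<Omega> \<longleftrightarrow> f \<in> borel_measurable (lebesgue_on \<Omega>) \<and> integrable (lebesgue_on \<Omega>) (\<lambda>x. (f x)\<^sup>2)"
  by (simp add: Lp_def abs_powr_2)

lemma Lp_2_add:
  fixes f g :: "'a::euclidean_space \<Rightarrow> real"
  assumes "f \<in> Lp 2 \<Omega>" "g \<in> Lp 2 \<Omega>"
  shows "(\<lambda>x. f x + g x) \<in> Lp 2 \<Omega>"
proof -
  have "integrable (lebesgue_on \<Omega>) (\<lambda>x. (f x + g x)\<^sup>2)"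
  proof (rule Bochner_Integration.integrable_bound)
    show "integrable (lebesgue_on \<Omega>) (\<lambda>x. 2 * (f x)\<^sup>2 + 2 * (g x)\<^sup>2)"
      using assms by (auto simp: Lp_2_iff)
    show "AE x in lebesgue_on \<Omega>. norm ((f x + g x)\<^sup>2) \<le> norm (2 * (f x)\<^sup>2 + 2 * (g x)\<^sup>2)"
    proof (rule AE_I2)
      fix x
      have "(f x + g x)\<^sup>2 \<le> 2 * (f x)\<^sup>2 + 2 * (g x)\<^sup>2"
        using sum_squares_bound[of "f x" "g x"] by (simp add: power2_sum)
      then show "norm ((f x + g x)\<^sup>2) \<le> norm (2 * (f x)\<^sup>2 + 2 * (g x)\<^sup>2)"
        by simp
    qed
  qed (use assms in \<open>auto simp: Lp_2_iff\<close>)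
  then show ?thesis using assms by (auto simp: Lp_2_iff)
qed

lemma Lp_2_uminus:
  fixes f :: "'a::euclidean_space \<Rightarrow> real"
  assumes "f \<in> Lp 2 \<Omega>"
  shows "(\<lambda>x. - f x) \<in> Lp 2 \<Omega>"
  using assms by (auto simp: Lp_2_iff)

text \<open>Removes the square root from convergence proofs: the norm is the root of the integral,
  and squaring and taking roots are continuous and fix 0.\<close>

lemma Lp_norm_2_tendsto_0_iff:
  fixes f :: "'i \<Rightarrow> 'a::euclidean_space \<Rightarrow> real"
  shows "((\<lambda>i. Lp_norm 2 \<Omega> (f i)) \<longlongrightarrow> 0) F \<longleftrightarrow> ((\<lambda>i. LINT x|lebesgue_on \<Omega>. (f i x)\<^sup>2) \<longlongrightarrow> 0) F"
proof -
  have nn: "0 \<le> (LINT x|lebesgue_on \<Omega>. (f i x)\<^sup>2)" for i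
    by simp
  have eq: "Lp_norm 2 \<Omega> (f i) = sqrt (LINT x|lebesgue_on \<Omega>. (f i x)\<^sup>2)" for i
    using nn[of i] by (simp add: Lp_norm_def abs_powr_2 powr_half_sqrt)
  show ?thesis
    unfolding eq
  proof
    assume "((\<lambda>i. sqrt (LINT x|lebesgue_on \<Omega>. (f i x)\<^sup>2)) \<longlongrightarrow> 0) F"
    then have "((\<lambda>i. (sqrt (LINT x|lebesgue_on \<Omega>. (f i x)\<^sup>2))\<^sup>2) \<longlongrightarrow> 0\<^sup>2) F"
      by (rule tendsto_power)
    then show "((\<lambda>i. LINT x|lebesgue_on \<Omega>. (f i x)\<^sup>2) \<longlongrightarrow> 0) F"
      using nn by simp
  next
    assume "((\<lambda>i. LINT x|lebesgue_on \<Omega>. (f i x)\<^sup>2) \<longlongrightarrow> 0) F"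
    from tendsto_real_sqrt[OF this]
    show "((\<lambda>i. sqrt (LINT x|lebesgue_on \<Omega>. (f i x)\<^sup>2)) \<longlongrightarrow> 0) F" by simp
  qed
qed

text \<open>With squared norms, the pointwise bound
  \<open>(a + b)\<^sup>2 \<le> 2 * a\<^sup>2 + 2 * b\<^sup>2\<close> takes the place of Minkowski's
  inequality; the integrated right-hand side tends to 0.\<close>

lemma Lp_tendsto_2_add:
  fixes f h :: "'i \<Rightarrow> 'a::euclidean_space \<Rightarrow> real"
  assumes "Lp_tendsto 2 \<Omega> f g F" "Lp_tendsto 2 \<Omega> h k F"
  shows "Lp_tendsto 2 \<Omega> (\<lambda>i x. f i x + h i x) (\<lambda>x. g x + k x) F"
proof -
  have f: "\<forall>\<^sub>F i in F. f i \<in> Lp 2 \<Omega>" and h: "\<forall>\<^sub>F i in F. h i \<in> Lp 2 \<Omega>"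
    and g: "g \<in> Lp 2 \<Omega>" and k: "k \<in> Lp 2 \<Omega>"
    using assms by (auto simp: Lp_tendsto_def)
  have "((\<lambda>i. 2 * (LINT x|lebesgue_on \<Omega>. (f i x - g x)\<^sup>2) + 2 * (LINT x|lebesgue_on \<Omega>. (h i x - k x)\<^sup>2))
      \<longlongrightarrow> 2 * 0 + 2 * 0) F"
    using assms by (intro tendsto_intros) (auto simp: Lp_tendsto_def Lp_norm_2_tendsto_0_iff)
  then have lim: "((\<lambda>i. 2 * (LINT x|lebesgue_on \<Omega>. (f i x - g x)\<^sup>2)
      + 2 * (LINT x|lebesgue_on \<Omega>. (h i x - k x)\<^sup>2)) \<longlongrightarrow> 0) F"
    by simp
  have "((\<lambda>i. LINT x|lebesgue_on \<Omega>. (f i x + h i x - (g x + k x))\<^sup>2) \<longlongrightarrow> 0) F"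
  proof (rule tendsto_sandwich[OF _ _ tendsto_const lim])
    show "\<forall>\<^sub>F i in F. (LINT x|lebesgue_on \<Omega>. (f i x + h i x - (g x + k x))\<^sup>2)
        \<le> 2 * (LINT x|lebesgue_on \<Omega>. (f i x - g x)\<^sup>2) + 2 * (LINT x|lebesgue_on \<Omega>. (h i x - k x)\<^sup>2)"
      using f h
    proof eventually_elim
      case (elim i)
      have fg: "(\<lambda>x. f i x - g x) \<in> Lp 2 \<Omega>" and hk: "(\<lambda>x. h i x - k x) \<in> Lp 2 \<Omega>"
        using Lp_2_add[OF elim(1) Lp_2_uminus[OF g]] Lp_2_add[OF elim(2) Lp_2_uminus[OF k]] by simp_all
      have "(LINT x|lebesgue_on \<Omega>. (f i x + h i x - (g x + k x))\<^sup>2)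
          \<le> (LINT x|lebesgue_on \<Omega>. 2 * (f i x - g x)\<^sup>2 + 2 * (h i x - k x)\<^sup>2)"
      proof (rule integral_mono)
        show "integrable (lebesgue_on \<Omega>) (\<lambda>x. (f i x + h i x - (g x + k x))\<^sup>2)"
          using Lp_2_add[OF fg hk] by (simp add: Lp_2_iff algebra_simps)
        show "integrable (lebesgue_on \<Omega>) (\<lambda>x. 2 * (f i x - g x)\<^sup>2 + 2 * (h i x - k x)\<^sup>2)"
          using fg hk by (auto simp: Lp_2_iff)
        show "(f i x + h i x - (g x + k x))\<^sup>2 \<le> 2 * (f i x - g x)\<^sup>2 + 2 * (h i x - k x)\<^sup>2" for x
          using sum_squares_bound[of "f i x - g x" "h i x - k x"]
            power2_sum[of "f i x - g x" "h i x - k x"]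
          by (simp add: algebra_simps)
      qed
      also have "\<dots> = 2 * (LINT x|lebesgue_on \<Omega>. (f i x - g x)\<^sup>2) + 2 * (LINT x|lebesgue_on \<Omega>. (h i x - k x)\<^sup>2)"
        using fg hk by (auto simp: Lp_2_iff)
      finally show ?case .
    qed
  qed simp
  then show ?thesis
    using eventually_elim2[OF f h Lp_2_add] Lp_2_add[OF g k]
    by (simp add: Lp_tendsto_def Lp_norm_2_tendsto_0_iff)
qed

lemma Lp_tendsto_2_uminus:
  fixes f :: "'i \<Rightarrow> 'a::euclidean_space \<Rightarrow> real"
  assumes "Lp_tendsto 2 \<Omega> f g F"
  shows "Lp_tendsto 2 \<Omega> (\<lambda>i x. - f i x) (\<lambda>x. - g x) F"
proof -
  have "(- f i x - - g x)\<^sup>2 = (f i x - g x)\<^sup>2" for i x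
    by (simp add: power2_commute)
  then show ?thesis
    using assms by (auto simp: Lp_tendsto_def Lp_norm_2_tendsto_0_iff Lp_2_uminus elim: eventually_mono)
qed

text \<open>Lets the real sequence of scaled multipliers be added to the gradients as constant
  functions. The squared distance is \<open>(c i - d)\<^sup>2\<close> times the finite measure of
  the domain.\<close>

lemma Lp_tendsto_2_const:
  fixes \<Omega> :: "'a::euclidean_space set"
  assumes "\<Omega> \<in> lmeasurable" "(c \<longlongrightarrow> d) F"
  shows "Lp_tendsto 2 \<Omega> (\<lambda>i x. c i) (\<lambda>x. d) F"
proof -
  interpret finite_measure "lebesgue_on \<Omega>"
    using assms(1) by (rule finite_measure_lebesgue_on)
  have "((\<lambda>i. (c i - d)\<^sup>2 * measure (lebesgue_on \<Omega>) (space (lebesgue_on \<Omega>))) \<longlongrightarrow>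
      (d - d)\<^sup>2 * measure (lebesgue_on \<Omega>) (space (lebesgue_on \<Omega>))) F"
    by (intro tendsto_intros assms(2))
  then show ?thesis
    by (simp add: Lp_tendsto_def Lp_norm_2_tendsto_0_iff Lp_2_iff mult.commute)
qed

text \<open>Needed because the update, and hence the formula for \<open>lam\<close>, holds only
  almost everywhere. Completeness supplies the measurability of \<open>h i\<close>.\<close>

lemma Lp_tendsto_AE_cong:
  fixes f h :: "'i \<Rightarrow> 'a::euclidean_space \<Rightarrow> real"
  assumes \<Omega>: "\<Omega> \<in> sets lebesgue" and lim: "Lp_tendsto p \<Omega> f g F"
    and ae: "\<And>i. AE x in lebesgue_on \<Omega>. f i x = h i x"
  shows "Lp_tendsto p \<Omega> h g F"
proof -
  have meas: "h i \<in> borel_measurable (lebesgue_on \<Omega>)" if "f i \<in> borel_measurable (lebesgue_on \<Omega>)" for i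
    using borel_measurable_AE_cong_lebesgue_on[OF \<Omega> that ae] .
  have mem: "h i \<in> Lp p \<Omega>" if "f i \<in> Lp p \<Omega>" for i
  proof -
    have f: "f i \<in> borel_measurable (lebesgue_on \<Omega>)"
      "integrable (lebesgue_on \<Omega>) (\<lambda>x. norm (f i x) powr p)"
      using that by (auto simp: Lp_def)
    have "integrable (lebesgue_on \<Omega>) (\<lambda>x. norm (h i x) powr p)"
    proof (rule integrable_cong_AE_imp[OF f(2)])
      show "(\<lambda>x. norm (h i x) powr p) \<in> borel_measurable (lebesgue_on \<Omega>)"
        using meas[OF f(1)] by measurable
      show "AE x in lebesgue_on \<Omega>. norm (f i x) powr p = norm (h i x) powr p"
        using ae[of i] by eventually_elim simp
    qed
    then show ?thesis using meas[OF f(1)] by (simp add: Lp_def)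
  qed
  have norm: "Lp_norm p \<Omega> (\<lambda>x. f i x - g x) = Lp_norm p \<Omega> (\<lambda>x. h i x - g x)"
    if "f i \<in> Lp p \<Omega>" for i
  proof -
    have "g \<in> borel_measurable (lebesgue_on \<Omega>)" "f i \<in> borel_measurable (lebesgue_on \<Omega>)"
      using lim that by (auto simp: Lp_tendsto_def Lp_def)
    note [measurable] = this meas[OF this(2)]
    have "(LINT x|lebesgue_on \<Omega>. norm (f i x - g x) powr p) = (LINT x|lebesgue_on \<Omega>. norm (h i x - g x) powr p)"
    proof (rule integral_cong_AE)
      show "AE x in lebesgue_on \<Omega>. norm (f i x - g x) powr p = norm (h i x - g x) powr p"
        using ae[of i] by eventually_elim simp
    qed measurable
    then show ?thesis by (simp add: Lp_norm_def)
  qed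
  have ev: "\<forall>\<^sub>F i in F. f i \<in> Lp p \<Omega>"
    using lim by (simp add: Lp_tendsto_def)
  have "((\<lambda>i. Lp_norm p \<Omega> (\<lambda>x. h i x - g x)) \<longlongrightarrow> 0) F"
    using lim tendsto_cong[OF eventually_mono[OF ev norm]] by (simp add: Lp_tendsto_def)
  then show ?thesis
    using lim eventually_mono[OF ev mem] by (simp add: Lp_tendsto_def)
qed

section \<open>The sigmoid and the SiMPL iterates\<close>

lemma sigmoid_pos: "0 < sigmoid t"
  and sigmoid_less_1: "sigmoid t < 1"
  by (simp_all add: sigmoid_def add_pos_pos)

lemma strict_mono_sigmoid: "strict_mono sigmoid"
  by (auto intro!: strict_monoI divide_strict_left_mono simp: sigmoid_def add_pos_pos)

lemma borel_measurable_sigmoid [measurable]: "sigmoid \<in> borel_measurable borel"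
  unfolding sigmoid_def[abs_def] by measurable

lemma sigmoid_logit:
  assumes "0 < y" "y < 1"
  shows "sigmoid (ln (y / (1 - y))) = y"
  using assms by (simp add: sigmoid_def exp_minus field_simps)

text \<open>\<open>inv\<close> is the choice inverse; its value is determined by injectivity only on
  the range of the sigmoid, hence the bounds on \<open>y\<close>.\<close>

lemma inv_sigmoid_eq:
  assumes "0 < y" "y < 1"
  shows "inv sigmoid y = ln (y / (1 - y))"
  using sigmoid_logit[OF assms] strict_mono_imp_inj_on[OF strict_mono_sigmoid] by (rule inv_f_eq[rotated])

lemma integrable_sigmoid:
  assumes "finite_measure M" "\<psi> \<in> borel_measurable M"
  shows "integrable M (\<lambda>x. sigmoid (\<psi> x))"
proof -
  note [measurable] = assms(2)
  show ?thesis
    using sigmoid_pos sigmoid_less_1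
    by (intro finite_measure.integrable_const_bound[OF assms(1), where B = 1])
       (auto simp: abs_of_pos less_imp_le)
qed

text \<open>A shift larger than \<open>a * B\<close> dominates \<open>a * g x\<close> almost
  everywhere, so the sigmoid moves strictly in one direction. Finite measure makes both integrals
  finite, and positive total mass turns the strict pointwise inequality into a strict one between
  integrals, against \<open>eq\<close>.\<close>

lemma sigmoid_multiplier_bound:
  assumes fin: "finite_measure M" and pos: "emeasure M (space M) \<noteq> 0"
    and [measurable]: "\<psi> \<in> borel_measurable M" "g \<in> borel_measurable M"
    and g: "AE x in M. \<bar>g x\<bar> \<le> B" and a: "0 \<le> a"
    and eq: "(LINT x|M. sigmoid (\<psi> x - a * g x - m)) = (LINT x|M. sigmoid (\<psi> x))"
  shows "\<bar>m\<bar> \<le> a * B"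
proof (rule ccontr)
  interpret finite_measure M by (rule fin)
  have int: "integrable M (\<lambda>x. sigmoid (\<psi> x - a * g x - m))" "integrable M (\<lambda>x. sigmoid (\<psi> x))"
    by (auto intro!: integrable_sigmoid[OF fin])
  assume "\<not> \<bar>m\<bar> \<le> a * B"
  then consider "m > a * B" | "m < - (a * B)" by linarith
  then show False
  proof cases
    case 1
    have "AE x in M. sigmoid (\<psi> x - a * g x - m) < sigmoid (\<psi> x)"
      using g
    proof eventually_elim
      case (elim x)
      then have "a * (- g x) \<le> a * B" by (intro mult_left_mono a) auto
      then show ?case using 1 by (intro strict_monoD[OF strict_mono_sigmoid]) simp
    qed
    from integral_less_AE_space[OF int this pos] eq show False by simp
  next
    case 2
    have "AE x in M. sigmoid (\<psi> x) < sigmoid (\<psi> x - a * g x - m)"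
      using g
    proof eventually_elim
      case (elim x)
      then have "a * g x \<le> a * B" by (intro mult_left_mono a) auto
      then show ?case using 2 by (intro strict_monoD[OF strict_mono_sigmoid]) simp
    qed
    from integral_less_AE_space[OF int(2,1) this pos] eq show False by simp
  qed
qed

lemma admissible_sigmoid:
  assumes \<Omega>: "\<Omega> \<in> sets lebesgue"
    and \<psi>[measurable]: "\<psi> \<in> borel_measurable (lebesgue_on \<Omega>)"
    and ae: "AE x in lebesgue_on \<Omega>. \<rho> x = sigmoid (\<psi> x)"
    and vol: "(LINT x|lebesgue_on \<Omega>. sigmoid (\<psi> x)) = \<theta> * measure lebesgue \<Omega>"
  shows "\<rho> \<in> admissible \<Omega> \<theta>"
proof -
  have "AE x in lebesgue_on \<Omega>. sigmoid (\<psi> x) = \<rho> x"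
    using ae by eventually_elim simp
  then have [measurable]: "\<rho> \<in> borel_measurable (lebesgue_on \<Omega>)"
    by (rule borel_measurable_AE_cong_lebesgue_on[OF \<Omega>, rotated]) measurable
  have bnd: "AE x in lebesgue_on \<Omega>. 0 \<le> \<rho> x \<and> \<rho> x \<le> 1"
    using ae by eventually_elim (auto simp: less_imp_le sigmoid_pos sigmoid_less_1)
  then have "AE x in lebesgue_on \<Omega>. \<bar>\<rho> x\<bar> \<le> 1"
    by eventually_elim simp
  then have "\<rho> \<in> Linf \<Omega>"
    by (intro LinfI_AE_bounded) simp_all
  moreover have "(LINT x|lebesgue_on \<Omega>. \<rho> x) = \<theta> * measure lebesgue \<Omega>"
    using ae unfolding vol[symmetric] by (intro integral_cong_AE) simp_all
  ultimately show ?thesis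
    using bnd by (simp add: admissible_def Linf_vol_def Linf_01_def)
qed

text \<open>The three claims are proved in one induction: admissibility of \<open>\<rho> k\<close>
  makes \<open>G (\<rho> k)\<close> measurable, which together with \<open>\<psi> k\<close> makes
  \<open>\<psi> (Suc k)\<close> measurable, and the multiplier equation gives the volume, whence
  \<open>\<rho> (Suc k)\<close> is admissible again.\<close>

lemma simpl_iterates:
  assumes \<Omega>: "\<Omega> \<in> sets lebesgue"
    and G: "\<And>r. r \<in> admissible \<Omega> \<theta> \<Longrightarrow> G r \<in> borel_measurable (lebesgue_on \<Omega>)"
    and it: "simpl_iteration \<Omega> \<theta> G \<alpha> \<rho> \<psi> \<mu>"
  shows "\<rho> k \<in> admissible \<Omega> \<theta>" (is ?A) and "\<psi> k \<in> borel_measurable (lebesgue_on \<Omega>)" (is ?B)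
    and "(LINT x|lebesgue_on \<Omega>. sigmoid (\<psi> k x)) = \<theta> * measure lebesgue \<Omega>" (is ?C)
proof -
  have init: "\<rho> 0 \<in> int_admissible \<Omega> \<theta>"
    and inv: "\<And>k. AE x in lebesgue_on \<Omega>. \<psi> k x = inv sigmoid (\<rho> k x)"
    and step: "\<And>k. AE x in lebesgue_on \<Omega>. \<psi> (Suc k) x = \<psi> k x - \<alpha> k * G (\<rho> k) x - \<mu> (Suc k)"
    and sig: "\<And>k. AE x in lebesgue_on \<Omega>. \<rho> (Suc k) x = sigmoid (\<psi> (Suc k) x)"
    and vol: "\<And>k. (LINT x|lebesgue_on \<Omega>. sigmoid (\<psi> k x - \<alpha> k * G (\<rho> k) x - \<mu> (Suc k)))
      = \<theta> * measure lebesgue \<Omega>"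
    using it by (auto simp: simpl_iteration_def)
  have "?A \<and> ?B \<and> ?C"
  proof (induction k)
    case 0
    have \<rho>0[measurable]: "\<rho> 0 \<in> borel_measurable (lebesgue_on \<Omega>)"
      and vol0: "(LINT x|lebesgue_on \<Omega>. \<rho> 0 x) = \<theta> * measure lebesgue \<Omega>"
      and "\<rho> 0 \<in> int_Linf_01 \<Omega>"
      using init by (auto simp: int_admissible_def Linf_vol_def Linf_def)
    note bnd = int_Linf_01_AE[OF this(3)]
    \<comment> \<open>The interior start keeps \<open>\<rho> 0\<close> strictly between 0 and 1, so
      the logit formula applies and measurability of \<open>\<psi> 0\<close> is read off from
      it.\<close>
    have \<psi>0: "AE x in lebesgue_on \<Omega>. ln (\<rho> 0 x / (1 - \<rho> 0 x)) = \<psi> 0 x"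
      using bnd inv[of 0] by eventually_elim (simp add: inv_sigmoid_eq)
    have [measurable]: "\<psi> 0 \<in> borel_measurable (lebesgue_on \<Omega>)"
      by (rule borel_measurable_AE_cong_lebesgue_on[OF \<Omega> _ \<psi>0]) measurable
    have ae: "AE x in lebesgue_on \<Omega>. \<rho> 0 x = sigmoid (\<psi> 0 x)"
      using bnd \<psi>0
    proof eventually_elim
      case (elim x)
      then show ?case using sigmoid_logit[of "\<rho> 0 x"] by simp
    qed
    have "(LINT x|lebesgue_on \<Omega>. \<rho> 0 x) = (LINT x|lebesgue_on \<Omega>. sigmoid (\<psi> 0 x))"
      using ae by (intro integral_cong_AE) simp_all
    then show ?case
      using admissible_sigmoid[OF \<Omega> _ ae] vol0 by simp
  next
    case (Suc k)
    then have [measurable]: "\<psi> k \<in> borel_measurable (lebesgue_on \<Omega>)"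
      "G (\<rho> k) \<in> borel_measurable (lebesgue_on \<Omega>)"
      using G by auto
    have ae: "AE x in lebesgue_on \<Omega>. \<psi> k x - \<alpha> k * G (\<rho> k) x - \<mu> (Suc k) = \<psi> (Suc k) x"
      using step[of k] by eventually_elim simp
    have [measurable]: "\<psi> (Suc k) \<in> borel_measurable (lebesgue_on \<Omega>)"
      by (rule borel_measurable_AE_cong_lebesgue_on[OF \<Omega> _ ae]) measurable
    have "AE x in lebesgue_on \<Omega>. sigmoid (\<psi> (Suc k) x)
        = sigmoid (\<psi> k x - \<alpha> k * G (\<rho> k) x - \<mu> (Suc k))"
      using step[of k] by eventually_elim simp
    then have "(LINT x|lebesgue_on \<Omega>. sigmoid (\<psi> (Suc k) x))
        = (LINT x|lebesgue_on \<Omega>. sigmoid (\<psi> k x - \<alpha> k * G (\<rho> k) x - \<mu> (Suc k)))"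
      by (intro integral_cong_AE) simp_all
    then show ?case
      using admissible_sigmoid[OF \<Omega> _ sig[of k]] vol[of k] by simp
  qed
  then show ?A ?B ?C by auto
qed

section \<open>Positive mass of the domain and the limit along a subsequence\<close>

lemma emeasure_lebesgue_on_open_neq_0:
  fixes \<Omega> :: "'a::euclidean_space set"
  assumes "open \<Omega>" "\<Omega> \<noteq> {}"
  shows "emeasure (lebesgue_on \<Omega>) (space (lebesgue_on \<Omega>)) \<noteq> 0"
proof
  have meas: "\<Omega> \<in> sets lebesgue"
    using assms(1) by simp
  assume "emeasure (lebesgue_on \<Omega>) (space (lebesgue_on \<Omega>)) = 0"
  then have "emeasure lebesgue \<Omega> = 0"
    using meas by (metis emeasure_restrict_space order_refl sets.Int_space_eq2 space_restrict_space)
  then have "negligible \<Omega>"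
    unfolding negligible_iff_null_sets using meas by (intro null_setsI)
  then show False
    using open_not_negligible[OF assms] by contradiction
qed

theorem proposition4p8:
  fixes \<Omega> \<Gamma>0 :: "(real^'n::finite) set"
    and C :: "real^'n^'n \<Rightarrow> real^'n^'n"
    and f :: "(real^'n \<Rightarrow> real^'n) \<Rightarrow> real"
    and \<theta> \<epsilon> \<rho>min s :: real
    and Fhat :: "(real^'n \<Rightarrow> real) \<Rightarrow> (real^'n \<Rightarrow> real^'n) \<Rightarrow> real"
    and F :: "(real^'n \<Rightarrow> real) \<Rightarrow> real"
    and gradF :: "(real^'n \<Rightarrow> real) \<Rightarrow> real^'n \<Rightarrow> real"
    and \<alpha> \<mu> :: "nat \<Rightarrow> real"
    and \<rho> \<psi> lam :: "nat \<Rightarrow> real^'n \<Rightarrow> real"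
    and \<rho>star :: "real^'n \<Rightarrow> real"
    and Kw :: "nat set"
  assumes dim: "CARD('n) = 2 \<or> CARD('n) = 3"
    and domain: "lipschitz_domain \<Omega>"
    and theta: "0 \<le> \<theta>" "\<theta> \<le> 1"
    and Gamma0: "\<Gamma>0 \<subseteq> frontier \<Omega>" "hausdorff_outer_measure (real CARD('n) - 1) \<Gamma>0 > 0"
    and tensor: "elasticity_tensor C"
    and force: "bounded_functional (V_space \<Omega> \<Gamma>0) (H1_vec_norm \<Omega>) f"
    and params: "\<epsilon> > 0" "0 < \<rho>min" "\<rho>min < 1" "s > 1"
    and Fhat_diff: "Fhat_differentiable \<Omega> Fhat"
    and F_def: "F = reduced_objective \<Omega> \<Gamma>0 C f \<rho>min s \<epsilon> Fhat"
    and gradient: "is_primal_gradient \<Omega> \<theta> F gradF"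
    and gradient_bounded: "\<exists>B. \<forall>r\<in>admissible \<Omega> \<theta>. Linf_norm \<Omega> (gradF r) \<le> B"
    and gradient_cc: "completely_continuous_L2 \<Omega> \<theta> gradF"
    and alpha: "\<And>k. \<alpha> k > 0"
    and iteration: "simpl_iteration \<Omega> \<theta> gradF \<alpha> \<rho> \<psi> \<mu>"
    and lam: "\<And>k. lam (Suc k) = (\<lambda>x. (\<psi> (Suc k) x - \<psi> k x) / \<alpha> k)"
    and Kw: "infinite Kw" "\<rho>star \<in> admissible \<Omega> \<theta>"
      "\<And>p. p \<ge> 1 \<Longrightarrow> Lp_weak_tendsto p \<Omega> \<rho> \<rho>star (along Kw)"
  shows "\<exists>Kw' \<mu>star lamstar. Kw' \<subseteq> Kw \<and> infinite Kw' \<and> lamstar \<in> Lp 2 \<Omega> \<and>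
           ((\<lambda>k. \<mu> (Suc k) / \<alpha> k) \<longlongrightarrow> \<mu>star) (along Kw') \<and>
           Lp_tendsto 2 \<Omega> (\<lambda>k. lam (Suc k)) lamstar (along Kw') \<and>
           (AE x in lebesgue_on \<Omega>. gradF \<rho>star x + lamstar x + \<mu>star = 0)"
proof -
  have "open \<Omega>" "\<Omega> \<noteq> {}" "bounded \<Omega>"
    using domain by (auto simp: lipschitz_domain_def)
  then have \<Omega>: "\<Omega> \<in> lmeasurable" "\<Omega> \<in> sets lebesgue"
    by (auto intro: bounded_set_imp_lmeasurable)
  note pos = emeasure_lebesgue_on_open_neq_0[OF \<open>open \<Omega>\<close> \<open>\<Omega> \<noteq> {}\<close>]
  have fin: "finite_measure (lebesgue_on \<Omega>)"
    using \<Omega>(1) by (rule finite_measure_lebesgue_on)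
  have grad: "gradF r \<in> Linf \<Omega>" if "r \<in> admissible \<Omega> \<theta>" for r
    using gradient that by (auto simp: is_primal_gradient_def)
  then have grad_meas: "gradF r \<in> borel_measurable (lebesgue_on \<Omega>)" if "r \<in> admissible \<Omega> \<theta>" for r
    using that by (auto simp: Linf_def)
  have iter: "\<rho> k \<in> admissible \<Omega> \<theta>" "\<psi> k \<in> borel_measurable (lebesgue_on \<Omega>)"
    "(LINT x|lebesgue_on \<Omega>. sigmoid (\<psi> k x)) = \<theta> * measure lebesgue \<Omega>" for k
    using simpl_iterates[OF \<Omega>(2) _ iteration] grad_meas by blast+
  have step: "AE x in lebesgue_on \<Omega>. \<psi> (Suc k) x = \<psi> k x - \<alpha> k * gradF (\<rho> k) x - \<mu> (Suc k)"
    and vol: "(LINT x|lebesgue_on \<Omega>. sigmoid (\<psi> k x - \<alpha> k * gradF (\<rho> k) x - \<mu> (Suc k)))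
      = \<theta> * measure lebesgue \<Omega>" for k
    using iteration by (auto simp: simpl_iteration_def)
  \<comment> \<open>One essential bound for all admissible densities makes the multiplier bound
    uniform in \<open>k\<close>. Convergence in \<open>L2\<close> alone would not control the
    essential suprema that the pointwise sigmoid comparison uses.\<close>
  obtain B where B: "\<And>r. r \<in> admissible \<Omega> \<theta> \<Longrightarrow> Linf_norm \<Omega> (gradF r) \<le> B"
    using gradient_bounded by blast
  have bound: "\<bar>\<mu> (Suc k) / \<alpha> k\<bar> \<le> B" for k
  proof -
    have "AE x in lebesgue_on \<Omega>. \<bar>gradF (\<rho> k) x\<bar> \<le> B"
      using Linf_norm_AE[OF grad[OF iter(1)]]
      by eventually_elim (rule order_trans[OF _ B[OF iter(1)]])
    \<comment> \<open>The integrals before and after the update both equal the prescribed volume, by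
      \<open>iter(3)\<close> and \<open>vol\<close>; this is the equality that the comparison
      needs.\<close>
    then have "\<bar>\<mu> (Suc k)\<bar> \<le> \<alpha> k * B"
      using alpha[of k] vol[of k] iter(3)[of k]
      by (intro sigmoid_multiplier_bound[OF fin pos iter(2)[of k] grad_meas[OF iter(1)[of k]]]) auto
    then show ?thesis
      using alpha[of k] by (simp add: field_simps)
  qed
  \<comment> \<open>\<open>Kw\<close> is enumerated first, so that the extraction \<open>s\<close>
    from the compact interval between \<open>- B\<close> and \<open>B\<close> selects only indices
    of \<open>Kw\<close>. This \<open>s\<close> is a sequence of indices, not the interpolation
    exponent.\<close>
  obtain e :: "nat \<Rightarrow> nat" where e: "strict_mono e" "\<And>n. e n \<in> Kw"
    using infinite_enumerate[OF Kw(1)] by metis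
  have "seq_compact (cball 0 B :: real set)"
    by (intro compact_imp_seq_compact compact_cball)
  moreover have "\<forall>n. \<mu> (Suc (e n)) / \<alpha> (e n) \<in> cball 0 B"
    using bound by simp
  ultimately obtain \<mu>star and s :: "nat \<Rightarrow> nat" where s: "strict_mono s"
    and \<mu>star: "((\<lambda>n. \<mu> (Suc (e n)) / \<alpha> (e n)) \<circ> s) \<longlonglongrightarrow> \<mu>star"
    by (rule seq_compactE) blast
  define d where "d = e \<circ> s"
  have d: "strict_mono d" "range d \<subseteq> Kw"
    using e s by (auto simp: d_def intro: strict_mono_o)
  \<comment> \<open>Complete continuity speaks of sequences indexed by all naturals, so the weak
    limit along \<open>Kw\<close> is first rewritten as one along the enumeration
    \<open>d\<close>.\<close>
  have "\<forall>p\<ge>1. Lp_weak_tendsto p \<Omega> (\<lambda>n. \<rho> (d n)) \<rho>star sequentially"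
    using Lp_weak_tendsto_compose[OF Kw(3) filterlim_along[OF d]] by simp
  then have grad_lim: "Lp_tendsto 2 \<Omega> (\<lambda>n. gradF (\<rho> (d n))) (gradF \<rho>star) sequentially"
    using gradient_cc[unfolded completely_continuous_L2_def, rule_format, of "\<lambda>n. \<rho> (d n)"] iter(1) Kw(2)
    by simp
  have \<mu>_lim: "(\<lambda>n. \<mu> (Suc (d n)) / \<alpha> (d n)) \<longlonglongrightarrow> \<mu>star"
    using \<mu>star by (simp add: d_def o_def)
  \<comment> \<open>Chosen by solving the stationarity equation, which then holds pointwise by
    definition; what remains is that \<open>lam\<close> converges to it.\<close>
  define lamstar where "lamstar = (\<lambda>x. - (gradF \<rho>star x + \<mu>star))"
  have "Lp_tendsto 2 \<Omega> (\<lambda>n x. - (gradF (\<rho> (d n)) x + \<mu> (Suc (d n)) / \<alpha> (d n))) lamstar sequentially"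
    unfolding lamstar_def
    by (intro Lp_tendsto_2_uminus Lp_tendsto_2_add grad_lim Lp_tendsto_2_const \<Omega>(1) \<mu>_lim)
  \<comment> \<open>The update divided by \<open>\<alpha> k\<close>, which is nonzero.\<close>
  moreover have "AE x in lebesgue_on \<Omega>. - (gradF (\<rho> k) x + \<mu> (Suc k) / \<alpha> k) = lam (Suc k) x" for k
    using step[of k]
  proof eventually_elim
    case (elim x)
    have "\<alpha> k \<noteq> 0" using alpha[of k] by simp
    then show ?case by (simp add: lam elim diff_divide_distrib add_divide_distrib)
  qed
  ultimately have lam_lim: "Lp_tendsto 2 \<Omega> (\<lambda>n. lam (Suc (d n))) lamstar sequentially"
    by (rule Lp_tendsto_AE_cong[OF \<Omega>(2)])
  \<comment> \<open>\<open>range d\<close> is the witness for \<open>Kw'\<close>;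
    \<open>along_range\<close> turns the limits along \<open>d\<close> into limits along this
    set.\<close>
  have "infinite (range d)"
    using strict_mono_imp_inj_on[OF d(1)] by (rule range_inj_infinite)
  moreover have "((\<lambda>k. \<mu> (Suc k) / \<alpha> k) \<longlongrightarrow> \<mu>star) (along (range d))"
    using \<mu>_lim by (simp add: along_range[OF d(1)] filterlim_filtermap)
  moreover have "Lp_tendsto 2 \<Omega> (\<lambda>k. lam (Suc k)) lamstar (along (range d))"
    using lam_lim by (simp add: along_range[OF d(1)] Lp_tendsto_filtermap)
  moreover have "lamstar \<in> Lp 2 \<Omega>"
    using lam_lim by (simp add: Lp_tendsto_def)
  moreover have "AE x in lebesgue_on \<Omega>. gradF \<rho>star x + lamstar x + \<mu>star = 0"
    by (simp add: lamstar_def)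
  ultimately show ?thesis
    using d(2) by blast
qed

end
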